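(* Let $\mathcal{Y}=\mathbb{R}$ and let the loss be the absolute loss $\ell(y,y')=|y-y'|$. For any training set size $n\in\mathbb{N}^*$, positive integer $d$, positive real number $b$ and input space $\mathcal{X}$ containing at least $\lfloor\log_2d\rfloor$ points, there exists a set $\mathcal{G}$ of $d$ prediction functions uniformly bounded by $b$ such that: for any estimator $\hat g$ there exists a probability distribution on $\mathcal{X}\times\mathbb{R}$ for which $\mathbb{E}|Y|<+\infty$ and $$\mathbb{E}R(\hat g)-\min_{g\in\mathcal{G}}R(g)\ge\frac b4\sqrt{\frac{\lfloor\log_2|\mathcal{G}|\rfloor}{n}\wedge\frac14}.$$
   Context: Prediction functions are (measurable) functions $\mathcal{X}\to\mathbb{R}$. For a distribution $P$ on $\mathcal{X}\times\mathbb{R}$, $R(g)=\mathbb{E}_{(X,Y)\sim P}|Y-g(X)|$. An estimator $\hat g$ maps a training set $Z_1^n\in(\mathcal{X}\times\mathbb{R})^n$ to a prediction function $\hat g_{Z_1^n}$; $\mathbb{E}R(\hat g)=\mathbb{E}_{Z_1^n\sim P^{\otimes n}}R(\hat g_{Z_1^n})$. $\lfloor x\rfloor$ is the largest integer not exceeding $x$, $a\wedge b=\min(a,b)$, and $|\mathcal{G}|=d$ is the cardinality of $\mathcal{G}$. Measurability of the manipulated quantities is implicitly assumed.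
   Formalization: The input space is assumed nonempty, and any two distinct points of it are separated by a measurable set; for a trivial sigma-algebra (only constant prediction functions) the claim fails for large n and d. *)

theory Defs
  imports "HOL-Probability.Probability"
begin

text \<open>
  The input space is \<^term>\<open>space M\<close> for a measurable space \<^term>\<open>M\<close>.  Functions on it are
  represented extensionally, so that two prediction functions are equal exactly when they agree
  on \<^term>\<open>space M\<close>, and cardinalities of sets of prediction functions are the intended ones.
\<close>

definition prediction_functions :: "'x measure \<Rightarrow> ('x \<Rightarrow> real) set" where
  "prediction_functions M = borel_measurable M \<inter> extensional (space M)"

definition distributions :: "'x measure \<Rightarrow> ('x \<times> real) measure set" where
  "distributions M = {P. prob_space P \<and> sets P = sets (M \<Otimes>\<^sub>M borel)}"

definition abs_loss :: "real \<Rightarrow> real \<Rightarrow> real" where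
  "abs_loss y y' = \<bar>y - y'\<bar>"

text \<open>
  Risks take values in the extended nonnegative reals, since the risk of an unbounded
  prediction function may be infinite.
\<close>

definition risk :: "('x \<times> real) measure \<Rightarrow> ('x \<Rightarrow> real) \<Rightarrow> ennreal" where
  "risk P g = (\<integral>\<^sup>+ (x, y). ennreal (abs_loss y (g x)) \<partial>P)"

definition training_sets :: "'x measure \<Rightarrow> nat \<Rightarrow> (nat \<Rightarrow> 'x \<times> real) measure" where
  "training_sets M n = (\<Pi>\<^sub>M i\<in>{1..n}. M \<Otimes>\<^sub>M borel)"

text \<open>
  The second condition is what is needed for the expected risk to be meaningful under every
  distribution; it is implied by joint measurability, see \<open>estimatorI_joint\<close> below.
\<close>

definition estimator :: "'x measure \<Rightarrow> nat \<Rightarrow> ((nat \<Rightarrow> 'x \<times> real) \<Rightarrow> 'x \<Rightarrow> real) \<Rightarrow> bool" where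
  "estimator M n h \<longleftrightarrow>
     (\<forall>z\<in>space (training_sets M n). h z \<in> prediction_functions M) \<and>
     (\<forall>P\<in>distributions M. (\<lambda>z. risk P (h z)) \<in> borel_measurable (training_sets M n))"

definition expected_risk ::
  "('x \<times> real) measure \<Rightarrow> nat \<Rightarrow> ((nat \<Rightarrow> 'x \<times> real) \<Rightarrow> 'x \<Rightarrow> real) \<Rightarrow> ennreal" where
  "expected_risk P n h = (\<integral>\<^sup>+ z. risk P (h z) \<partial>(\<Pi>\<^sub>M i\<in>{1..n}. P))"

text \<open>
  Distinct inputs can be told apart by measurable sets.  This holds in particular when
  singletons are measurable.  Without it, distinct points of the input space may be
  indistinguishable to every (measurable) prediction function.
\<close>

definition separates_points :: "'x measure \<Rightarrow> bool" where
  "separates_points M \<longleftrightarrow>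
     (\<forall>x\<in>space M. \<forall>x'\<in>space M. x \<noteq> x' \<longrightarrow> (\<exists>A\<in>sets M. x \<in> A \<and> x' \<notin> A))"

lemma estimatorI_joint:
  assumes ext: "\<And>z. z \<in> space (training_sets M n) \<Longrightarrow> h z \<in> extensional (space M)"
    and joint: "(\<lambda>(z, x). h z x) \<in> borel_measurable (training_sets M n \<Otimes>\<^sub>M M)"
  shows "estimator M n h"
  unfolding estimator_def prediction_functions_def
proof (intro conjI ballI IntI)
  fix z assume z: "z \<in> space (training_sets M n)"
  show "h z \<in> borel_measurable M"
    using measurable_compose[OF measurable_Pair1'[OF z] joint] by simp
  show "h z \<in> extensional (space M)" by (rule ext[OF z])
next
  fix P assume "P \<in> distributions M"
  then have P: "prob_space P" and [measurable_cong]: "sets P = sets (M \<Otimes>\<^sub>M borel)"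
    by (auto simp: distributions_def)
  interpret prob_space P by (rule P)
  note joint[measurable]
  have "(\<lambda>w. h (fst w) (fst (snd w))) \<in> borel_measurable (training_sets M n \<Otimes>\<^sub>M P)"
    using measurable_compose[OF _ joint, of "\<lambda>w. (fst w, fst (snd w))" "training_sets M n \<Otimes>\<^sub>M P"]
    by simp
  then have "(\<lambda>(z, w). ennreal (abs_loss (snd w) (h z (fst w))))
      \<in> borel_measurable (training_sets M n \<Otimes>\<^sub>M P)"
    unfolding abs_loss_def case_prod_beta by measurable
  from borel_measurable_nn_integral[OF this]
  show "(\<lambda>z. risk P (h z)) \<in> borel_measurable (training_sets M n)"
    by (simp add: risk_def case_prod_beta')
qed

end

theory Submission
  imports Defs
begin

text \<open>
  This is an Assouad argument. Let \<open>m = \<lfloor>log\<^sub>2 d\<rfloor>\<close> and let the class contain, for each sign pattern on \<open>m\<close>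
  separated points, a function taking the values \<open>\<plusminus>b\<close> accordingly. Under the law of a pattern the
  input is uniform on the \<open>m\<close> points, and the label is the signed value of the pattern with
  probability \<open>(1 + \<xi>) / 2\<close> and its opposite otherwise. Predicting \<open>v\<close> at a point of sign \<open>t\<close> then
  costs an excess of at least \<open>\<xi> b (1 - t u)\<close>, where \<open>u\<close> is \<open>v / b\<close> clipped to \<open>[-1, 1]\<close>.

  The laws of two patterns that differ in one sign have Hellinger affinity
  \<open>1 - (1 - sqrt (1 - \<xi>\<^sup>2)) / m\<close>. For \<open>\<xi> = sqrt (min (m / n) (1 / 4)) / 2\<close> the affinity of their \<open>n\<close>-fold
  products has square at least \<open>3 / 4\<close>, so the total variation distance is at most \<open>1 / 2\<close>. Averaged over
  all patterns, each point thus contributes at least \<open>\<xi> b / (2 m)\<close> to the excess risk.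
\<close>

section \<open>Le Cam's two-point testing bound\<close>

text \<open>Let \<open>a\<close> be the common mass of \<open>p\<close> and \<open>q\<close>; their
  pointwise maximum then has mass \<open>2 - a\<close>. Cauchy-Schwarz for
  \<open>sqrt (min * max)\<close> bounds the squared affinity by
  \<open>a * (2 - a) = 1 - (1 - a)\<^sup>2\<close>. The weights \<open>1 - u\<close> and
  \<open>1 + u\<close> are nonnegative and add up to 2, so the total error is at least
  \<open>2 * a\<close>.\<close>

lemma two_point_testing_bound:
  fixes p q u :: "'a \<Rightarrow> real"
  assumes fin: "finite Z"
    and p: "\<And>z. z \<in> Z \<Longrightarrow> 0 \<le> p z" "sum p Z = 1"
    and q: "\<And>z. z \<in> Z \<Longrightarrow> 0 \<le> q z" "sum q Z = 1"
    and u: "\<And>z. z \<in> Z \<Longrightarrow> \<bar>u z\<bar> \<le> 1"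
  shows "2 * (1 - sqrt (1 - (\<Sum>z\<in>Z. sqrt (p z * q z))\<^sup>2))
    \<le> (\<Sum>z\<in>Z. p z * (1 - u z)) + (\<Sum>z\<in>Z. q z * (1 + u z))"
proof -
  define a where "a = (\<Sum>z\<in>Z. min (p z) (q z))"
  have max: "(\<Sum>z\<in>Z. max (p z) (q z)) = 2 - a"
  proof -
    have "(\<Sum>z\<in>Z. max (p z) (q z)) + a = (\<Sum>z\<in>Z. p z + q z)"
      unfolding a_def sum.distrib[symmetric] by (intro sum.cong) auto
    also have "\<dots> = 2" by (simp add: sum.distrib p q)
    finally show ?thesis by simp
  qed
  have "(\<Sum>z\<in>Z. sqrt (p z * q z))
      = (\<Sum>z\<in>Z. sqrt (min (p z) (q z)) * sqrt (max (p z) (q z)))"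
    by (intro sum.cong refl) (auto simp: real_sqrt_mult min_def max_def)
  also have "\<dots>\<^sup>2 \<le> (\<Sum>z\<in>Z. (sqrt (min (p z) (q z)))\<^sup>2) * (\<Sum>z\<in>Z. (sqrt (max (p z) (q z)))\<^sup>2)"
    by (rule Cauchy_Schwarz_ineq_sum)
  also have "\<dots> = a * (2 - a)"
  proof -
    have "(\<Sum>z\<in>Z. (sqrt (min (p z) (q z)))\<^sup>2) = a"
      unfolding a_def using p q by (intro sum.cong) auto
    moreover have "(\<Sum>z\<in>Z. (sqrt (max (p z) (q z)))\<^sup>2) = 2 - a"
      unfolding max[symmetric] using p q by (intro sum.cong) (auto simp: max_def)
    ultimately show ?thesis by simp
  qed
  finally have "(1 - a)\<^sup>2 \<le> 1 - (\<Sum>z\<in>Z. sqrt (p z * q z))\<^sup>2"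
    by (simp add: power2_eq_square algebra_simps)
  then have "1 - a \<le> sqrt (1 - (\<Sum>z\<in>Z. sqrt (p z * q z))\<^sup>2)"
    by (rule real_le_rsqrt)
  then have "2 * (1 - sqrt (1 - (\<Sum>z\<in>Z. sqrt (p z * q z))\<^sup>2)) \<le> 2 * a" by simp
  also have "2 * a \<le> (\<Sum>z\<in>Z. p z * (1 - u z) + q z * (1 + u z))"
    unfolding a_def sum_distrib_left
  proof (rule sum_mono)
    fix z assume z: "z \<in> Z"
    have "min (p z) (q z) * (1 - u z) \<le> p z * (1 - u z)"
      "min (p z) (q z) * (1 + u z) \<le> q z * (1 + u z)"
      using u[OF z] by (auto intro!: mult_right_mono)
    then show "2 * min (p z) (q z) \<le> p z * (1 - u z) + q z * (1 + u z)"
      by (simp add: algebra_simps)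
  qed
  finally show ?thesis by (simp add: sum.distrib)
qed

section \<open>Sign patterns and the discrete observation model\<close>

text \<open>A sign pattern is encoded as the set of its positive indices, so that the patterns on
  \<open>m\<close> points are the members of \<open>Pow {..<m}\<close>.\<close>

definition flip :: "'a \<Rightarrow> 'a set \<Rightarrow> 'a set" where
  "flip j S = (if j \<in> S then S - {j} else insert j S)"

lemma flip_flip [simp]: "flip j (flip j S) = S"
  by (auto simp: flip_def)

lemma mem_flip_iff: "i \<in> flip j S \<longleftrightarrow> (if i = j then i \<notin> S else i \<in> S)"
  by (auto simp: flip_def)

lemma flip_subset: "S \<subseteq> A \<Longrightarrow> j \<in> A \<Longrightarrow> flip j S \<subseteq> A"
  by (auto simp: flip_def)

lemma sum_Pow_flip:
  assumes "j \<in> A"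
  shows "(\<Sum>S\<in>Pow A. f (flip j S)) = (\<Sum>S\<in>Pow A. f S)"
  by (rule sum.reindex_bij_witness[of _ "flip j" "flip j"]) (auto simp: flip_subset assms dest: flip_subset[OF _ assms])

definition label_sign :: "'a \<Rightarrow> 'a set \<Rightarrow> real" where
  "label_sign j S = (if j \<in> S then 1 else -1)"

text \<open>The mass function of one observation: the index of a uniformly drawn point, and a
  Boolean in which \<open>True\<close> stands for the label \<open>b\<close> and
  \<open>False\<close> for \<open>-b\<close>. As a plain real function it lets affinities be
  computed as finite sums.\<close>

definition label_prob :: "nat \<Rightarrow> real \<Rightarrow> nat set \<Rightarrow> nat \<times> bool \<Rightarrow> real" where
  "label_prob m \<xi> S = (\<lambda>(j, s). (if s = (j \<in> S) then (1 + \<xi>) / 2 else (1 - \<xi>) / 2) / real m)"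

text \<open>The free choice of \<open>s\<close> allows the two labels at each point to be listed
  with the likely one first, which avoids a case distinction on the pattern.\<close>

lemma sum_labels: "(\<Sum>k\<in>{..<m} \<times> UNIV. f k) = (\<Sum>j<m. f (j, s j) + f (j, \<not> s j))"
proof -
  have "(\<Sum>t\<in>UNIV. f (j, t)) = f (j, s j) + f (j, \<not> s j)" for j
    by (cases "s j") (auto simp: UNIV_bool add.commute)
  then show ?thesis
    using sum.cartesian_product[of "\<lambda>j t. f (j, t)" "UNIV :: bool set" "{..<m}"] by simp
qed

lemma label_prob_nonneg: "\<bar>\<xi>\<bar> \<le> 1 \<Longrightarrow> 0 \<le> label_prob m \<xi> S k"
  by (auto simp: label_prob_def split: prod.split)

lemma sum_label_prob:
  assumes "m > 0"
  shows "(\<Sum>k\<in>{..<m} \<times> UNIV. label_prob m \<xi> S k) = 1"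
  using assms
  by (subst sum_labels[where s = "\<lambda>j. j \<in> S"])
     (simp add: label_prob_def add_divide_distrib[symmetric])

text \<open>The two laws differ only at the index \<open>j\<close>, where the masses \<alpha> and
  \<beta> of the two labels are exchanged. Every other index contributes
  \<open>\<alpha> + \<beta> = 1 / m\<close>, while \<open>j\<close> contributes
  \<open>2 * sqrt (\<alpha> * \<beta>)\<close>.\<close>

lemma label_prob_affinity:
  assumes "j < m" "\<bar>\<xi>\<bar> \<le> 1"
  shows "(\<Sum>k\<in>{..<m} \<times> UNIV. sqrt (label_prob m \<xi> S k * label_prob m \<xi> (flip j S) k))
    = 1 - (1 - sqrt (1 - \<xi>\<^sup>2)) / real m"
proof -
  have m: "real m > 0" using assms by simp
  define \<alpha> \<beta> where "\<alpha> = (1 + \<xi>) / 2 / real m" and "\<beta> = (1 - \<xi>) / 2 / real m"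
  have label: "label_prob m \<xi> T (i, s) = (if s = (i \<in> T) then \<alpha> else \<beta>)" for T i s
    by (simp add: label_prob_def \<alpha>_def \<beta>_def)
  have "\<alpha> * \<beta> = (1 - \<xi>\<^sup>2) / (2 * real m)\<^sup>2"
    using m by (simp add: \<alpha>_def \<beta>_def field_simps power2_eq_square)
  then have "sqrt (\<alpha> * \<beta>) = sqrt (1 - \<xi>\<^sup>2) / \<bar>2 * real m\<bar>"
    by (simp only: real_sqrt_divide real_sqrt_abs)
  then have "2 * sqrt (\<alpha> * \<beta>) = sqrt (1 - \<xi>\<^sup>2) / real m" by simp
  moreover have "0 \<le> \<alpha>" "0 \<le> \<beta>" using assms by (auto simp: \<alpha>_def \<beta>_def)
  moreover have "\<alpha> + \<beta> = 1 / real m" by (simp add: \<alpha>_def \<beta>_def add_divide_distrib[symmetric])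
  ultimately have *: "sqrt (label_prob m \<xi> S (i, i \<in> S) * label_prob m \<xi> (flip j S) (i, i \<in> S)) +
      sqrt (label_prob m \<xi> S (i, i \<notin> S) * label_prob m \<xi> (flip j S) (i, i \<notin> S)) =
      (if i = j then sqrt (1 - \<xi>\<^sup>2) / m else 1 / m)" for i
    by (auto simp: label mem_flip_iff mult.commute[of \<beta> \<alpha>])
  have "(\<Sum>k\<in>{..<m} \<times> UNIV. sqrt (label_prob m \<xi> S k * label_prob m \<xi> (flip j S) k)) =
      (\<Sum>i<m. if i = j then sqrt (1 - \<xi>\<^sup>2) / m else 1 / m)"
    by (subst sum_labels[where s = "\<lambda>i. i \<in> S"]) (simp add: *)
  also have "\<dots> = (\<Sum>i<m. 1 / m + (if i = j then sqrt (1 - \<xi>\<^sup>2) / m - 1 / m else 0))"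
    by (intro sum.cong) auto
  also have "\<dots> = 1 + (sqrt (1 - \<xi>\<^sup>2) / m - 1 / m)"
    using assms m by (simp add: sum.distrib)
  finally show ?thesis by (simp add: diff_divide_distrib)
qed

section \<open>Samples of size \<open>n\<close> and their affinity\<close>

definition sample_prob :: "nat \<Rightarrow> nat \<Rightarrow> real \<Rightarrow> nat set \<Rightarrow> (nat \<Rightarrow> nat \<times> bool) \<Rightarrow> real" where
  "sample_prob m n \<xi> S z = (\<Prod>i\<in>{1..n}. label_prob m \<xi> S (z i))"

abbreviation samples :: "nat \<Rightarrow> nat \<Rightarrow> (nat \<Rightarrow> nat \<times> bool) set" where
  "samples m n \<equiv> {1..n} \<rightarrow>\<^sub>E {..<m} \<times> UNIV"

lemma finite_samples: "finite (samples m n)"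
  by (auto intro: finite_PiE)

lemma sum_prod_samples:
  fixes f :: "nat \<times> bool \<Rightarrow> real"
  shows "(\<Sum>z\<in>samples m n. \<Prod>i\<in>{1..n}. f (z i)) = (\<Sum>k\<in>{..<m} \<times> UNIV. f k) ^ n"
  by (subst prod_sum_PiE[symmetric]) auto

lemma sample_prob_nonneg: "\<bar>\<xi>\<bar> \<le> 1 \<Longrightarrow> 0 \<le> sample_prob m n \<xi> S z"
  by (auto simp: sample_prob_def intro!: prod_nonneg label_prob_nonneg)

lemma sum_sample_prob: "m > 0 \<Longrightarrow> (\<Sum>z\<in>samples m n. sample_prob m n \<xi> S z) = 1"
  by (simp only: sample_prob_def sum_prod_samples sum_label_prob power_one)

text \<open>Hellinger affinity is multiplicative over independent observations: the square root
  passes into the product, and the sum over samples factors.\<close>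

lemma sample_prob_affinity:
  assumes "j < m" "\<bar>\<xi>\<bar> \<le> 1"
  shows "(\<Sum>z\<in>samples m n. sqrt (sample_prob m n \<xi> S z * sample_prob m n \<xi> (flip j S) z))
    = (1 - (1 - sqrt (1 - \<xi>\<^sup>2)) / real m) ^ n"
proof -
  have sqrt_prod: "sqrt (\<Prod>i\<in>I. f i) = (\<Prod>i\<in>I. sqrt (f i))" for f :: "nat \<Rightarrow> real" and I
    by (induction I rule: infinite_finite_induct) (auto simp: real_sqrt_mult)
  show ?thesis
    unfolding sample_prob_def prod.distrib[symmetric] sqrt_prod
      sum_prod_samples[of "\<lambda>k. sqrt (label_prob m \<xi> S k * label_prob m \<xi> (flip j S) k)"]
      label_prob_affinity[OF assms] ..
qed

text \<open>
  In the proof, Bernoulli's inequality is applied to the exponent \<open>n\<close>, before squaring: applied to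
  the exponent \<open>2 n\<close> directly, it only gives a bound slightly below \<open>3 / 4\<close>.
\<close>

lemma sample_prob_affinity_ge:
  assumes "j < m" "0 \<le> \<xi>" "\<xi> \<le> 1 / 4" "real n * \<xi>\<^sup>2 \<le> real m / 4"
  shows "3 / 4 \<le> (\<Sum>z\<in>samples m n. sqrt (sample_prob m n \<xi> S z * sample_prob m n \<xi> (flip j S) z))\<^sup>2"
proof -
  define s where "s = sqrt (1 - \<xi>\<^sup>2)"
  have m: "real m > 0" using assms by simp
  have \<xi>2: "\<xi>\<^sup>2 \<le> 1 / 16" using power_mono[OF assms(3,2), of 2] by (simp add: power2_eq_square)
  \<comment> \<open>A rational lower bound for \<open>sqrt (15 / 16)\<close>; the factor
    \<open>49 / 25\<close> below is \<open>1 + 24 / 25\<close>.\<close>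
  have "24 / 25 \<le> s"
    unfolding s_def using \<xi>2 by (intro real_le_rsqrt) (simp add: power2_eq_square)
  moreover have "s \<le> 1" unfolding s_def by simp
  ultimately have s: "24 / 25 \<le> s" "s \<le> 1" .
  have "1 - \<xi>\<^sup>2 = s\<^sup>2" unfolding s_def using \<xi>2 by simp
  then have "(1 - s) * (1 + s) = \<xi>\<^sup>2" by (simp add: algebra_simps power2_eq_square)
  moreover have "(1 - s) * (49 / 25) \<le> (1 - s) * (1 + s)"
    using s by (intro mult_left_mono) auto
  ultimately have "1 - s \<le> 25 / 49 * \<xi>\<^sup>2" by simp
  then have "real n * (1 - s) \<le> 25 / 49 * (real n * \<xi>\<^sup>2)"
    using mult_left_mono[of "1 - s" "25 / 49 * \<xi>\<^sup>2" "real n"] by (simp add: algebra_simps)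
  also have "\<dots> \<le> 25 / 196 * real m" using assms(4) by simp
  finally have "real n * ((1 - s) / m) \<le> 25 / 196" using m by (simp add: field_simps)
  moreover have "1 + real n * (- ((1 - s) / m)) \<le> (1 + - ((1 - s) / m)) ^ n"
  proof (rule Bernoulli_inequality)
    have "1 - s \<le> 1" using s by simp
    also have "1 \<le> real m" using m by simp
    finally show "- 1 \<le> - ((1 - s) / m)" using m by (simp add: field_simps)
  qed
  \<comment> \<open>\<open>171 / 196\<close> is \<open>1 - 25 / 196\<close>, and its square still
    exceeds \<open>3 / 4\<close>.\<close>
  ultimately have "171 / 196 \<le> (1 - (1 - s) / m) ^ n" by simp
  then have "(171 / 196)\<^sup>2 \<le> ((1 - (1 - s) / m) ^ n)\<^sup>2" by (intro power_mono) auto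
  then show ?thesis
    using assms by (subst sample_prob_affinity) (auto simp: s_def power2_eq_square)
qed

section \<open>Averaging over all patterns\<close>

text \<open>For each \<open>j\<close>, the errors at \<open>j\<close> under a pattern and under its
  flip at \<open>j\<close> add up to at least 1. Since \<open>flip j\<close> permutes the patterns,
  summing this over all of them counts every error twice. The total error, summed over
  \<open>j\<close>, is therefore at least \<open>m / 2\<close> on average over the patterns, and
  some pattern reaches the average.\<close>

lemma assouad_bound:
  fixes u :: "(nat \<Rightarrow> nat \<times> bool) \<Rightarrow> nat \<Rightarrow> real"
  assumes m: "m > 0" and \<xi>: "0 \<le> \<xi>" "\<xi> \<le> 1 / 4" "real n * \<xi>\<^sup>2 \<le> real m / 4"
    and u: "\<And>z j. \<bar>u z j\<bar> \<le> 1"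
  shows "\<exists>S\<subseteq>{..<m}. real m / 2 \<le>
    (\<Sum>z\<in>samples m n. sample_prob m n \<xi> S z * (\<Sum>j<m. 1 - label_sign j S * u z j))"
proof -
  define e where "e S j = (\<Sum>z\<in>samples m n. sample_prob m n \<xi> S z * (1 - label_sign j S * u z j))" for S j
  have pair: "1 \<le> e S j + e (flip j S) j" if j: "j < m" for S j
  proof -
    have "3 / 4 \<le> (\<Sum>z\<in>samples m n. sqrt (sample_prob m n \<xi> S z * sample_prob m n \<xi> (flip j S) z))\<^sup>2"
      by (rule sample_prob_affinity_ge[OF j \<xi>])
    \<comment> \<open>With affinity squared at least \<open>3 / 4\<close>, the testing bound becomes
      \<open>2 * (1 - 1 / 2) = 1\<close>. It is applied to \<open>label_sign j S * u z j\<close>,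
      whose sign is reversed by the flip.\<close>
    then have "sqrt (1 - (\<Sum>z\<in>samples m n. sqrt (sample_prob m n \<xi> S z * sample_prob m n \<xi> (flip j S) z))\<^sup>2) \<le> 1 / 2"
      by (intro real_le_lsqrt) (auto simp: power2_eq_square)
    moreover have "2 * (1 - sqrt (1 - (\<Sum>z\<in>samples m n. sqrt (sample_prob m n \<xi> S z * sample_prob m n \<xi> (flip j S) z))\<^sup>2))
      \<le> (\<Sum>z\<in>samples m n. sample_prob m n \<xi> S z * (1 - label_sign j S * u z j)) +
        (\<Sum>z\<in>samples m n. sample_prob m n \<xi> (flip j S) z * (1 + label_sign j S * u z j))"
      using \<xi> m u
      by (intro two_point_testing_bound finite_samples sample_prob_nonneg sum_sample_prob)
         (auto simp: label_sign_def)
    moreover have "label_sign j (flip j S) = - label_sign j S" by (auto simp: label_sign_def mem_flip_iff)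
    ultimately show ?thesis unfolding e_def by simp
  qed
  have "(\<Sum>S\<in>Pow {..<m}. real m / 2) \<le> (\<Sum>S\<in>Pow {..<m}. \<Sum>j<m. e S j)"
  proof -
    have "(\<Sum>j<m. \<Sum>S\<in>Pow {..<m}. (1::real)) \<le> (\<Sum>j<m. \<Sum>S\<in>Pow {..<m}. e S j + e (flip j S) j)"
      by (intro sum_mono pair) auto
    also have "\<dots> = 2 * (\<Sum>j<m. \<Sum>S\<in>Pow {..<m}. e S j)"
    proof -
      have "(\<Sum>j<m. \<Sum>S\<in>Pow {..<m}. e (flip j S) j) = (\<Sum>j<m. \<Sum>S\<in>Pow {..<m}. e S j)"
        using sum_Pow_flip[of _ "{..<m}" "\<lambda>S. e S _"] by (intro sum.cong[of "{..<m}"]) auto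
      then show ?thesis by (simp add: sum.distrib)
    qed
    also have "(\<Sum>j<m. \<Sum>S\<in>Pow {..<m}. e S j) = (\<Sum>S\<in>Pow {..<m}. \<Sum>j<m. e S j)"
      by (rule sum.swap)
    finally show ?thesis by (simp add: mult.commute)
  qed
  then have "\<exists>S\<in>Pow {..<m}. real m / 2 \<le> (\<Sum>j<m. e S j)"
    using sum_strict_mono[of "Pow {..<m}" "\<lambda>S. \<Sum>j<m. e S j" "\<lambda>_. real m / 2"]
    by (auto simp: not_le[symmetric])
  moreover have "(\<Sum>j<m. e S j) =
      (\<Sum>z\<in>samples m n. sample_prob m n \<xi> S z * (\<Sum>j<m. 1 - label_sign j S * u z j))" for S
    unfolding e_def by (subst sum.swap) (simp only: sum_distrib_left)
  ultimately show ?thesis by auto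
qed

section \<open>From product measures to finite sums\<close>

text \<open>A product measure is determined by its values on boxes, and the preimage of a box under
  the coordinatewise map is again a box, on which \<open>Pi_pmf\<close> factors.\<close>

lemma PiM_distr_pmf:
  assumes I: "finite I" and f: "\<And>k. f k \<in> space N"
  shows "PiM I (\<lambda>_. distr (measure_pmf p) N f) =
    distr (measure_pmf (Pi_pmf I undefined (\<lambda>_. p))) (PiM I (\<lambda>_. N)) (\<lambda>z. \<lambda>i\<in>I. f (z i))"
proof (rule product_sigma_finite.PiM_eqI[symmetric])
  have f_meas: "f \<in> measurable (measure_pmf p) N" for p using f by (auto simp: measurable_def)
  have prob: "prob_space (distr (measure_pmf p) N f)"
    by (intro prob_space.prob_space_distr f_meas measure_pmf.prob_space_axioms)
  show "product_sigma_finite (\<lambda>_. distr (measure_pmf p) N f)"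
    using prob by (simp add: product_sigma_finite_def prob_space_imp_sigma_finite)
  show "finite I" by (rule I)
  show "sets (distr (measure_pmf (Pi_pmf I undefined (\<lambda>_. p))) (PiM I (\<lambda>_. N)) (\<lambda>z. \<lambda>i\<in>I. f (z i))) =
      sets (PiM I (\<lambda>_. distr (measure_pmf p) N f))"
    by (simp cong: sets_PiM_cong)
next
  have f_meas: "f \<in> measurable (measure_pmf p) N" for p using f by (auto simp: measurable_def)
  have g_meas: "(\<lambda>z. \<lambda>i\<in>I. f (z i)) \<in> measurable (measure_pmf q) (PiM I (\<lambda>_. N))" for q
    using f by (auto simp: measurable_def space_PiM)
  fix A assume "\<And>i. i \<in> I \<Longrightarrow> A i \<in> sets (distr (measure_pmf p) N f)"
  then have A: "A i \<in> sets N" if "i \<in> I" for i using that by simp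
  have "emeasure (distr (measure_pmf (Pi_pmf I undefined (\<lambda>_. p))) (PiM I (\<lambda>_. N)) (\<lambda>z. \<lambda>i\<in>I. f (z i))) (Pi\<^sub>E I A)
      = emeasure (measure_pmf (Pi_pmf I undefined (\<lambda>_. p))) ((\<lambda>z. \<lambda>i\<in>I. f (z i)) -` Pi\<^sub>E I A)"
    using A I by (subst emeasure_distr[OF g_meas]) (auto intro!: sets_PiM_I_finite)
  also have "(\<lambda>z. \<lambda>i\<in>I. f (z i)) -` Pi\<^sub>E I A = Pi I (\<lambda>i. f -` A i)"
    by (auto simp: PiE_iff Pi_iff)
  also have "emeasure (measure_pmf (Pi_pmf I undefined (\<lambda>_. p))) (Pi I (\<lambda>i. f -` A i)) =
      (\<Prod>i\<in>I. emeasure (measure_pmf p) (f -` A i))"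
    using I by (simp add: measure_pmf.emeasure_eq_measure measure_Pi_pmf_Pi prod_ennreal)
  also have "\<dots> = (\<Prod>i\<in>I. emeasure (distr (measure_pmf p) N f) (A i))"
    using A by (intro prod.cong refl) (simp add: emeasure_distr[OF f_meas])
  finally show "emeasure (distr (measure_pmf (Pi_pmf I undefined (\<lambda>_. p))) (PiM I (\<lambda>_. N)) (\<lambda>z. \<lambda>i\<in>I. f (z i))) (Pi\<^sub>E I A)
      = (\<Prod>i\<in>I. emeasure (distr (measure_pmf p) N f) (A i))" .
qed

lemma nn_integral_PiM_distr_pmf:
  fixes F :: "('i \<Rightarrow> 'a) \<Rightarrow> ennreal"
  assumes I: "finite I" and f: "\<And>k. f k \<in> space N"
    and K: "finite K" "set_pmf p \<subseteq> K"
    and F: "F \<in> borel_measurable (PiM I (\<lambda>_. N))"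
  shows "(\<integral>\<^sup>+ z. F z \<partial>(PiM I (\<lambda>_. distr (measure_pmf p) N f))) =
    (\<Sum>z\<in>I \<rightarrow>\<^sub>E K. F (\<lambda>i\<in>I. f (z i)) * ennreal (\<Prod>i\<in>I. pmf p (z i)))"
proof -
  have "(\<lambda>z. \<lambda>i\<in>I. f (z i)) \<in> measurable (measure_pmf q) (PiM I (\<lambda>_. N))" for q
    using f by (auto simp: measurable_def space_PiM)
  then have "(\<integral>\<^sup>+ z. F z \<partial>(PiM I (\<lambda>_. distr (measure_pmf p) N f))) =
      (\<integral>\<^sup>+ z. F (\<lambda>i\<in>I. f (z i)) \<partial>measure_pmf (Pi_pmf I undefined (\<lambda>_. p)))"
    using F by (simp add: PiM_distr_pmf[OF I f] nn_integral_distr)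
  also have "\<dots> = (\<Sum>z\<in>I \<rightarrow>\<^sub>E K. F (\<lambda>i\<in>I. f (z i)) * ennreal (pmf (Pi_pmf I undefined (\<lambda>_. p)) z))"
  proof (rule nn_integral_measure_pmf_support)
    show "finite (I \<rightarrow>\<^sub>E K)" using I K by (intro finite_PiE) auto
    \<comment> \<open>The default value \<open>undefined\<close> of \<open>Pi_pmf\<close> is that of
      extensional functions, so the support lies inside \<open>I \<rightarrow>\<^sub>E K\<close> and
      this case is vacuous.\<close>
    fix z assume "z \<in> set_pmf (Pi_pmf I undefined (\<lambda>_. p))" "z \<notin> I \<rightarrow>\<^sub>E K"
    moreover from this have "z \<in> I \<rightarrow>\<^sub>E K"
      using set_Pi_pmf_subset'[OF I, of undefined "\<lambda>_. p"] K by (fastforce simp: PiE_dflt_def)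
    ultimately show "F (\<lambda>i\<in>I. f (z i)) = 0" by simp
  qed auto
  also have "\<dots> = (\<Sum>z\<in>I \<rightarrow>\<^sub>E K. F (\<lambda>i\<in>I. f (z i)) * ennreal (\<Prod>i\<in>I. pmf p (z i)))"
    using I by (intro sum.cong refl) (subst pmf_Pi', auto)
  finally show ?thesis .
qed

lemma distr_pmf_in_distributions:
  assumes "\<And>k. f k \<in> space (M \<Otimes>\<^sub>M borel)"
  shows "distr (measure_pmf p) (M \<Otimes>\<^sub>M borel) f \<in> distributions M"
  using assms
  by (auto simp: distributions_def measurable_def intro!: prob_space.prob_space_distr measure_pmf.prob_space_axioms)

lemma expected_risk_distr_pmf:
  assumes f: "\<And>k. f k \<in> space (M \<Otimes>\<^sub>M borel)"
    and K: "finite K" "set_pmf p \<subseteq> K"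
    and h: "estimator M n h"
  defines "P \<equiv> distr (measure_pmf p) (M \<Otimes>\<^sub>M borel) f"
  shows "expected_risk P n h =
    (\<Sum>z\<in>{1..n} \<rightarrow>\<^sub>E K. risk P (h (\<lambda>i\<in>{1..n}. f (z i))) * ennreal (\<Prod>i\<in>{1..n}. pmf p (z i)))"
proof -
  \<comment> \<open>The second condition in \<open>estimator\<close> supplies the measurability that
    the change of variables requires.\<close>
  have "(\<lambda>z. risk P (h z)) \<in> borel_measurable (PiM {1..n} (\<lambda>_. M \<Otimes>\<^sub>M borel))"
    using h distr_pmf_in_distributions[of f M p, OF f]
    by (simp add: estimator_def P_def training_sets_def)
  from nn_integral_PiM_distr_pmf[OF _ f K this] show ?thesis
    unfolding expected_risk_def P_def by simp
qed

lemma risk_distr_pmf: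
  assumes f: "\<And>k. f k \<in> space (M \<Otimes>\<^sub>M borel)"
    and K: "finite K" "set_pmf p \<subseteq> K"
    and g: "g \<in> borel_measurable M"
  shows "risk (distr (measure_pmf p) (M \<Otimes>\<^sub>M borel) f) g =
    ennreal (\<Sum>k\<in>K. abs_loss (snd (f k)) (g (fst (f k))) * pmf p k)"
proof -
  have "f \<in> measurable (measure_pmf p) (M \<Otimes>\<^sub>M borel)" using f by (auto simp: measurable_def)
  moreover have "(\<lambda>(x, y). ennreal (abs_loss y (g x))) \<in> borel_measurable (M \<Otimes>\<^sub>M borel)"
    using g unfolding abs_loss_def by measurable
  ultimately have "risk (distr (measure_pmf p) (M \<Otimes>\<^sub>M borel) f) g =
      (\<integral>\<^sup>+ k. ennreal (abs_loss (snd (f k)) (g (fst (f k)))) \<partial>measure_pmf p)"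
    unfolding risk_def by (simp add: nn_integral_distr case_prod_beta)
  also have "\<dots> = (\<Sum>k\<in>K. ennreal (abs_loss (snd (f k)) (g (fst (f k)))) * ennreal (pmf p k))"
    using K by (intro nn_integral_measure_pmf_support) auto
  also have "\<dots> = (\<Sum>k\<in>K. ennreal (abs_loss (snd (f k)) (g (fst (f k))) * pmf p k))"
    by (intro sum.cong refl) (simp add: ennreal_mult abs_loss_def)
  also have "\<dots> = ennreal (\<Sum>k\<in>K. abs_loss (snd (f k)) (g (fst (f k))) * pmf p k)"
    by (intro sum_ennreal) (simp add: abs_loss_def)
  finally show ?thesis .
qed

section \<open>The observation law as a pmf\<close>

text \<open>The coin decides whether the label agrees with the pattern. Building the law from
  independent draws makes it a probability law by construction.\<close>

definition label_pmf :: "nat \<Rightarrow> real \<Rightarrow> nat set \<Rightarrow> (nat \<times> bool) pmf" where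
  "label_pmf m \<xi> S = map_pmf (\<lambda>(j, a). (j, a = (j \<in> S)))
     (pair_pmf (pmf_of_set {..<m}) (bernoulli_pmf ((1 + \<xi>) / 2)))"

lemma set_label_pmf: "m > 0 \<Longrightarrow> set_pmf (label_pmf m \<xi> S) \<subseteq> {..<m} \<times> UNIV"
  by (subgoal_tac "{..<m} \<noteq> {}") (auto simp: label_pmf_def)

lemma pmf_label_pmf:
  assumes "m > 0" "\<bar>\<xi>\<bar> \<le> 1" "k \<in> {..<m} \<times> UNIV"
  shows "pmf (label_pmf m \<xi> S) k = label_prob m \<xi> S k"
proof -
  obtain j s where k: "k = (j, s)" "j < m" using assms by auto
  have inj: "inj (\<lambda>(j, a). (j, a = (j \<in> S)))" by (auto simp: inj_def)
  \<comment> \<open>For fixed \<open>S\<close> the map is an involution, so the preimage of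
    \<open>(j, s)\<close> is its image.\<close>
  have "k = (\<lambda>(j, a). (j, a = (j \<in> S))) (j, s = (j \<in> S))" using k by auto
  then have "pmf (label_pmf m \<xi> S) k =
      pmf (pair_pmf (pmf_of_set {..<m}) (bernoulli_pmf ((1 + \<xi>) / 2))) (j, s = (j \<in> S))"
    unfolding label_pmf_def by (simp only: pmf_map_inj'[OF inj])
  also have "\<dots> = label_prob m \<xi> S k"
  proof -
    have "pmf (pmf_of_set {..<m}) j = 1 / m"
      using assms(1) k(2) by (subst pmf_of_set) auto
    then show ?thesis
      using assms k by (auto simp: pmf_pair label_prob_def field_simps)
  qed
  finally show ?thesis .
qed

section \<open>Excess loss at a single point\<close>

definition clip :: "real \<Rightarrow> real" where
  "clip v = max (-1) (min 1 v)"

lemma abs_clip_le: "\<bar>clip v\<bar> \<le> 1"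
  by (auto simp: clip_def)

text \<open>In units of \<open>b\<close>, a prediction \<open>w\<close> in \<open>[-1, 1]\<close>
  has expected loss exactly \<open>1 - \<xi> * t * w\<close>; outside this interval the loss is at
  least that of the nearest endpoint, which is \<open>clip w\<close>. The first summand
  \<open>b * (1 - \<xi>)\<close> is the loss of predicting \<open>t * b\<close>.\<close>

lemma two_label_risk_ge:
  assumes "b > 0" "\<bar>\<xi>\<bar> \<le> 1" "t = 1 \<or> t = -1"
  shows "b * (1 - \<xi>) + \<xi> * b * (1 - t * clip (v / b))
    \<le> (1 + \<xi>) / 2 * \<bar>t * b - v\<bar> + (1 - \<xi>) / 2 * \<bar>- t * b - v\<bar>"
proof -
  define w where "w = v / b"
  have v: "v = b * w" using assms by (simp add: w_def)
  have "1 - \<xi> * (t * clip w) \<le> (1 + \<xi>) / 2 * \<bar>t - w\<bar> + (1 - \<xi>) / 2 * \<bar>- t - w\<bar>"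
  proof -
    consider "w < -1" | "-1 \<le> w" "w \<le> 1" | "1 < w" by linarith
    then show ?thesis
      using assms(2,3) by cases (auto simp: clip_def abs_if field_simps)
  qed
  then have "b * (1 - \<xi> * (t * clip w)) \<le> b * ((1 + \<xi>) / 2 * \<bar>t - w\<bar> + (1 - \<xi>) / 2 * \<bar>- t - w\<bar>)"
    using assms(1) by (intro mult_left_mono) auto
  moreover have "\<bar>t * b - v\<bar> = b * \<bar>t - w\<bar>" "\<bar>- t * b - v\<bar> = b * \<bar>- t - w\<bar>"
    using assms(1) by (simp_all add: v abs_mult_pos' algebra_simps)
  ultimately show ?thesis unfolding w_def[symmetric] by (simp add: algebra_simps)
qed

section \<open>Construction of the class\<close>

text \<open>Each pattern is realised by a function with values \<open>b\<close> and
  \<open>-b\<close>. These are at most \<open>2 ^ m\<close> functions, and the class is padded to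
  exactly \<open>d\<close> members from the infinite set of prediction functions bounded by
  \<open>b\<close>.\<close>

lemma prediction_class_exists:
  fixes M :: "'x measure" and x :: "nat \<Rightarrow> 'x"
  assumes b: "b > 0" and M: "space M \<noteq> {}" "separates_points M"
    and x: "inj_on x {..<m}" "\<And>j. j < m \<Longrightarrow> x j \<in> space M"
    and d: "2 ^ m \<le> d"
  shows "\<exists>G\<subseteq>prediction_functions M. finite G \<and> card G = d \<and>
    (\<forall>g\<in>G. \<forall>x\<in>space M. \<bar>g x\<bar> \<le> b) \<and>
    (\<forall>S\<subseteq>{..<m}. \<exists>g\<in>G. \<forall>j<m. g (x j) = label_sign j S * b)"
proof -
  have "\<forall>i j. \<exists>A. i < m \<longrightarrow> j < m \<longrightarrow> i \<noteq> j \<longrightarrow> A \<in> sets M \<and> x i \<in> A \<and> x j \<notin> A"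
    using M(2) x unfolding separates_points_def by (metis inj_onD lessThan_iff)
  then obtain A where "\<forall>i j. i < m \<longrightarrow> j < m \<longrightarrow> i \<noteq> j \<longrightarrow> A i j \<in> sets M \<and> x i \<in> A i j \<and> x j \<notin> A i j"
    by metis
  then have A: "A i j \<in> sets M" "x i \<in> A i j" "x j \<notin> A i j"
    if "i < m" "j < m" "i \<noteq> j" for i j using that by auto
  \<comment> \<open>\<open>B i\<close> contains \<open>x i\<close> and no other chosen point. The
    factor \<open>space M\<close> keeps it measurable when \<open>m = 1\<close>, where the
    intersection is over an empty family.\<close>
  define B where "B i = space M \<inter> (\<Inter>j\<in>{..<m} - {i}. A i j)" for i
  have B_sets: "B i \<in> sets M" if "i < m" for i
    using that A unfolding B_def by (cases "{..<m} - {i} = {}") (auto intro!: sets.Int sets.finite_INT)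
  have x_B: "x j \<in> B i \<longleftrightarrow> i = j" if "i < m" "j < m" for i j
  proof (cases "i = j")
    case True
    then show ?thesis using that A(2) x(2) by (auto simp: B_def)
  next
    case False
    then show ?thesis using that A(3)[of i j] by (auto simp: B_def)
  qed
  define g where "g S = restrict (\<lambda>y. if y \<in> (\<Union>i\<in>S. B i) then b else - b) (space M)" for S
  define F where "F = {f \<in> prediction_functions M. \<forall>y\<in>space M. \<bar>f y\<bar> \<le> b}"
  have g_F: "g S \<in> F" if "S \<subseteq> {..<m}" for S
  proof -
    have "(\<Union>i\<in>S. B i) \<in> sets M"
      using that B_sets finite_subset[OF that] by (intro sets.finite_UN) auto
    then have "(\<lambda>y. if y \<in> (\<Union>i\<in>S. B i) then b else - b) \<in> borel_measurable M"
      by (intro measurable_If_set) (auto intro!: sets.Int)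
    then have "g S \<in> borel_measurable M"
      unfolding g_def by (simp cong: measurable_cong)
    then show ?thesis using b by (auto simp: F_def prediction_functions_def g_def)
  qed
  have g_x: "g S (x j) = label_sign j S * b" if "S \<subseteq> {..<m}" "j < m" for S j
    using that x(2) x_B by (fastforce simp: g_def label_sign_def)
  \<comment> \<open>The constants in \<open>{0..b}\<close> are pairwise distinct members, because
    the input space is nonempty.\<close>
  have "infinite F"
  proof
    assume "finite F"
    moreover have "(\<lambda>c. \<lambda>y\<in>space M. c) ` {0..b} \<subseteq> F"
      by (auto simp: F_def prediction_functions_def cong: measurable_cong)
    moreover have "inj_on (\<lambda>c. \<lambda>y\<in>space M. c) {0..b}"
      using M(1) by (auto simp: inj_on_def fun_eq_iff restrict_def)
    ultimately have "finite {0..b}" by (meson finite_imageD finite_subset)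
    then show False using b infinite_Icc by blast
  qed
  define G0 where "G0 = g ` Pow {..<m}"
  have G0: "finite G0" "G0 \<subseteq> F" "card G0 \<le> d"
    using g_F card_image_le[of "Pow {..<m}" g] d by (auto simp: G0_def card_Pow)
  have "infinite (F - G0)" using \<open>infinite F\<close> G0 by simp
  then obtain E where E: "finite E" "card E = d - card G0" "E \<subseteq> F - G0"
    using infinite_arbitrarily_large by metis
  have "card (G0 \<union> E) = d" using E G0 by (subst card_Un_disjoint) auto
  moreover have "G0 \<union> E \<subseteq> F" using E G0 by auto
  moreover have "\<forall>S\<subseteq>{..<m}. \<exists>f\<in>G0 \<union> E. \<forall>j<m. f (x j) = label_sign j S * b"
    using g_x by (auto simp: G0_def)
  ultimately show ?thesis using E(1) G0(1) unfolding F_def by (intro exI[of _ "G0 \<union> E"]) auto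
qed

section \<open>The laws of the patterns and their risks\<close>

definition labelled_point :: "(nat \<Rightarrow> 'x) \<Rightarrow> real \<Rightarrow> nat \<times> bool \<Rightarrow> 'x \<times> real" where
  "labelled_point x b = (\<lambda>(j, s). (x j, if s then b else - b))"

definition cube_law :: "'x measure \<Rightarrow> (nat \<Rightarrow> 'x) \<Rightarrow> real \<Rightarrow> nat \<Rightarrow> real \<Rightarrow> nat set \<Rightarrow> ('x \<times> real) measure" where
  "cube_law M x b m \<xi> S =
     distr (measure_pmf (label_pmf m \<xi> S)) (M \<Otimes>\<^sub>M borel) (labelled_point x b)"

lemma labelled_point_in_space:
  "(\<And>j. x j \<in> space M) \<Longrightarrow> labelled_point x b k \<in> space (M \<Otimes>\<^sub>M borel)"
  by (auto simp: labelled_point_def space_pair_measure split: prod.split)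

lemma risk_cube_law:
  assumes x: "\<And>j. x j \<in> space M" and m: "m > 0" and \<xi>: "\<bar>\<xi>\<bar> \<le> 1"
    and g: "g \<in> borel_measurable M"
  shows "risk (cube_law M x b m \<xi> S) g = ennreal ((\<Sum>j<m.
    (1 + \<xi>) / 2 * \<bar>label_sign j S * b - g (x j)\<bar> +
    (1 - \<xi>) / 2 * \<bar>- label_sign j S * b - g (x j)\<bar>) / real m)"
proof -
  have "risk (cube_law M x b m \<xi> S) g =
    ennreal (\<Sum>k\<in>{..<m} \<times> UNIV. abs_loss (snd (labelled_point x b k)) (g (fst (labelled_point x b k)))
      * pmf (label_pmf m \<xi> S) k)"
    unfolding cube_law_def
    by (rule risk_distr_pmf[OF labelled_point_in_space[OF x] _ set_label_pmf[OF m] g]) simp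
  also have "(\<Sum>k\<in>{..<m} \<times> UNIV. abs_loss (snd (labelled_point x b k)) (g (fst (labelled_point x b k)))
      * pmf (label_pmf m \<xi> S) k) =
    (\<Sum>k\<in>{..<m} \<times> UNIV. abs_loss (snd (labelled_point x b k)) (g (fst (labelled_point x b k)))
      * label_prob m \<xi> S k)"
    using m \<xi> by (intro sum.cong refl) (simp add: pmf_label_pmf)
  also have "\<dots> = (\<Sum>j<m. ((1 + \<xi>) / 2 * \<bar>label_sign j S * b - g (x j)\<bar> +
      (1 - \<xi>) / 2 * \<bar>- label_sign j S * b - g (x j)\<bar>) / real m)"
    by (subst sum_labels[where s = "\<lambda>j. j \<in> S"], intro sum.cong refl)
       (auto simp: labelled_point_def label_prob_def abs_loss_def label_sign_def field_simps)
  finally show ?thesis by (simp only: sum_divide_distrib)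
qed

text \<open>Such a function errs by \<open>2 * b\<close> exactly when the label disagrees with the
  pattern, which has probability \<open>(1 - \<xi>) / 2\<close>.\<close>

lemma risk_cube_law_optimal:
  assumes "\<And>j. x j \<in> space M" "m > 0" "\<bar>\<xi>\<bar> \<le> 1" "b > 0"
    and "g \<in> borel_measurable M" "\<And>j. j < m \<Longrightarrow> g (x j) = label_sign j S * b"
  shows "risk (cube_law M x b m \<xi> S) g = ennreal (b * (1 - \<xi>))"
proof -
  have "(\<Sum>j<m. (1 + \<xi>) / 2 * \<bar>label_sign j S * b - g (x j)\<bar> +
      (1 - \<xi>) / 2 * \<bar>- label_sign j S * b - g (x j)\<bar>) = (\<Sum>j<m. b * (1 - \<xi>))"
    using assms by (intro sum.cong) (auto simp: label_sign_def)
  then show ?thesis using assms by (subst risk_cube_law) auto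
qed

lemma risk_cube_law_ge:
  assumes "\<And>j. x j \<in> space M" "m > 0" "\<bar>\<xi>\<bar> \<le> 1" "b > 0"
    and "g \<in> borel_measurable M"
  shows "ennreal (b * (1 - \<xi>) + \<xi> * b / real m * (\<Sum>j<m. 1 - label_sign j S * clip (g (x j) / b)))
    \<le> risk (cube_law M x b m \<xi> S) g"
proof -
  have "b * (1 - \<xi>) + \<xi> * b / real m * (\<Sum>j<m. 1 - label_sign j S * clip (g (x j) / b)) =
      (\<Sum>j<m. b * (1 - \<xi>) + \<xi> * b * (1 - label_sign j S * clip (g (x j) / b))) / real m"
    using assms(2) by (simp add: sum.distrib sum_distrib_left[symmetric] add_divide_distrib)
  also have "\<dots> \<le> (\<Sum>j<m. (1 + \<xi>) / 2 * \<bar>label_sign j S * b - g (x j)\<bar> +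
      (1 - \<xi>) / 2 * \<bar>- label_sign j S * b - g (x j)\<bar>) / real m"
    using assms(3,4) by (intro divide_right_mono sum_mono two_label_risk_ge) (auto simp: label_sign_def)
  finally show ?thesis using assms by (subst risk_cube_law) (auto intro: ennreal_leI)
qed

text \<open>Clipping the estimator's predictions at the \<open>m\<close> points gives an admissible
  \<open>u\<close> for \<open>assouad_bound\<close>. The error \<open>m / 2\<close> found there is
  scaled by \<open>\<xi> * b / m\<close>, the price of one unit of error in
  \<open>risk_cube_law_ge\<close>.\<close>

lemma expected_risk_cube_law_ge:
  assumes x: "\<And>j. x j \<in> space M" and m: "m > 0" and b: "b > 0"
    and \<xi>: "0 \<le> \<xi>" "\<xi> \<le> 1 / 4" "real n * \<xi>\<^sup>2 \<le> real m / 4"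
    and h: "estimator M n h"
  shows "\<exists>S\<subseteq>{..<m}. ennreal (b * (1 - \<xi>) + \<xi> * b / 2) \<le> expected_risk (cube_law M x b m \<xi> S) n h"
proof -
  define h' where "h' z = h (\<lambda>i\<in>{1..n}. labelled_point x b (z i))" for z
  define u where "u z j = clip (h' z (x j) / b)" for z j
  obtain S where S: "S \<subseteq> {..<m}" and le: "real m / 2 \<le>
      (\<Sum>z\<in>samples m n. sample_prob m n \<xi> S z * (\<Sum>j<m. 1 - label_sign j S * u z j))"
    using assouad_bound[OF m \<xi>, of u] abs_clip_le unfolding u_def by blast
  \<comment> \<open>\<open>r z\<close> is the lower bound of \<open>risk_cube_law_ge\<close> for the
    function learnt from the sample \<open>z\<close>.\<close>
  define r where "r z = b * (1 - \<xi>) + \<xi> * b / real m * (\<Sum>j<m. 1 - label_sign j S * u z j)" for z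
  have h'_meas: "h' z \<in> borel_measurable M" for z
  proof -
    have "(\<lambda>i\<in>{1..n}. labelled_point x b (z i)) \<in> space (training_sets M n)"
      using labelled_point_in_space[OF x] by (auto simp: training_sets_def space_PiM)
    then show ?thesis using h by (auto simp: h'_def estimator_def prediction_functions_def)
  qed
  have r_nonneg: "0 \<le> r z" for z
    unfolding r_def using b \<xi> abs_clip_le
    by (intro add_nonneg_nonneg mult_nonneg_nonneg sum_nonneg)
       (auto simp: label_sign_def u_def abs_le_iff add_nonneg_nonneg minus_le_iff)
  have "b * (1 - \<xi>) + \<xi> * b / 2 \<le> b * (1 - \<xi>) + \<xi> * b / real m *
      (\<Sum>z\<in>samples m n. sample_prob m n \<xi> S z * (\<Sum>j<m. 1 - label_sign j S * u z j))"
    using mult_left_mono[OF le, of "\<xi> * b / real m"] b \<xi>(1) m by (simp add: field_simps)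
  \<comment> \<open>The constant term is multiplied by the total mass 1 so that both terms merge
    into one sum over samples.\<close>
  also have "\<dots> = b * (1 - \<xi>) * (\<Sum>z\<in>samples m n. sample_prob m n \<xi> S z) + \<xi> * b / real m *
      (\<Sum>z\<in>samples m n. sample_prob m n \<xi> S z * (\<Sum>j<m. 1 - label_sign j S * u z j))"
    by (simp only: sum_sample_prob[OF m] mult_1_right)
  also have "\<dots> = (\<Sum>z\<in>samples m n. r z * sample_prob m n \<xi> S z)"
    unfolding r_def distrib_right sum.distrib
    by (simp only: sum_distrib_left[where A = "samples m n"] mult_ac)
  finally have "ennreal (b * (1 - \<xi>) + \<xi> * b / 2) \<le> ennreal (\<Sum>z\<in>samples m n. r z * sample_prob m n \<xi> S z)"
    by (rule ennreal_leI)
  also have "\<dots> = (\<Sum>z\<in>samples m n. ennreal (r z) * ennreal (sample_prob m n \<xi> S z))"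
    using r_nonneg \<xi> by (subst sum_ennreal[symmetric]) (auto simp: ennreal_mult sample_prob_nonneg)
  also have "\<dots> \<le> (\<Sum>z\<in>samples m n. risk (cube_law M x b m \<xi> S) (h' z) * ennreal (sample_prob m n \<xi> S z))"
    unfolding r_def u_def using \<xi>
    by (intro sum_mono mult_right_mono risk_cube_law_ge x m b h'_meas) auto
  also have "\<dots> = (\<Sum>z\<in>samples m n. risk (cube_law M x b m \<xi> S) (h' z) *
      ennreal (\<Prod>i\<in>{1..n}. pmf (label_pmf m \<xi> S) (z i)))"
  proof (intro sum.cong refl)
    fix z assume z: "z \<in> samples m n"
    have "sample_prob m n \<xi> S z = (\<Prod>i\<in>{1..n}. pmf (label_pmf m \<xi> S) (z i))"
      unfolding sample_prob_def using \<xi> z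
      by (intro prod.cong refl pmf_label_pmf[symmetric] m) (auto simp: PiE_iff)
    then show "risk (cube_law M x b m \<xi> S) (h' z) * ennreal (sample_prob m n \<xi> S z) =
      risk (cube_law M x b m \<xi> S) (h' z) * ennreal (\<Prod>i\<in>{1..n}. pmf (label_pmf m \<xi> S) (z i))" by simp
  qed
  also have "\<dots> = expected_risk (cube_law M x b m \<xi> S) n h"
    unfolding cube_law_def h'_def
    by (rule expected_risk_distr_pmf[OF labelled_point_in_space[OF x] _ set_label_pmf[OF m] h, symmetric]) simp
  finally show ?thesis using S by blast
qed

lemma nn_integral_abs_label_cube_law:
  assumes "\<And>j. x j \<in> space M" "b > 0"
  shows "(\<integral>\<^sup>+ (x, y). ennreal \<bar>y\<bar> \<partial>cube_law M x b m \<xi> S) = ennreal b"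
proof -
  have "labelled_point x b \<in> measurable (measure_pmf (label_pmf m \<xi> S)) (M \<Otimes>\<^sub>M borel)"
    using labelled_point_in_space[OF assms(1)] by (auto simp: measurable_def)
  moreover have "\<bar>snd (labelled_point x b k)\<bar> = b" for k
    using assms(2) by (auto simp: labelled_point_def split: prod.split)
  ultimately show ?thesis
    unfolding cube_law_def
    by (simp add: nn_integral_distr case_prod_beta measure_pmf.emeasure_space_1)
qed

section \<open>The choice of parameters and the final bound\<close>

text \<open>The first bound makes room for all \<open>2 ^ m\<close> patterns in a class of
  \<open>d\<close> functions; the second settles the degenerate case without any point.\<close>

lemma floor_log2_bounds:
  assumes "d \<ge> 1" "\<lfloor>log 2 (real d)\<rfloor> = int m"
  shows "2 ^ m \<le> d" "m = 0 \<Longrightarrow> d = 1"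
proof -
  have "real m \<le> log 2 (real d)" "log 2 (real d) < real m + 1"
    using assms(2) by linarith+
  then have "2 powr real m \<le> real d" "real d < 2 powr (real m + 1)"
    using assms(1) by (simp_all add: le_log_iff log_less_iff)
  then show "2 ^ m \<le> d" "m = 0 \<Longrightarrow> d = 1"
    using assms(1) by (simp_all add: powr_realpow)
qed

theorem theorem8p5:
  fixes M :: "'x measure" and n d :: nat and b :: real
  assumes "n \<ge> 1" and "d \<ge> 1" and "b > 0"
    and "space M \<noteq> {}" and "separates_points M"
    and "\<exists>S\<subseteq>space M. finite S \<and> int (card S) = \<lfloor>log 2 (real d)\<rfloor>"
  shows "\<exists>G. G \<subseteq> prediction_functions M \<and> finite G \<and> card G = d \<and>
           (\<forall>g\<in>G. \<forall>x\<in>space M. \<bar>g x\<bar> \<le> b) \<and>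
           (\<forall>h. estimator M n h \<longrightarrow>
             (\<exists>P\<in>distributions M.
                (\<integral>\<^sup>+ (x, y). ennreal \<bar>y\<bar> \<partial>P) < \<infinity> \<and>
                enn2ereal (expected_risk P n h) - enn2ereal (Min (risk P ` G))
                  \<ge> ereal (b / 4 * sqrt (min (real_of_int \<lfloor>log 2 (real (card G))\<rfloor> / real n) (1 / 4)))))"
proof -
  obtain V where V: "V \<subseteq> space M" "finite V" "int (card V) = \<lfloor>log 2 (real d)\<rfloor>"
    using assms(6) by auto
  define m where "m = card V"
  have floor: "\<lfloor>log 2 (real d)\<rfloor> = int m" using V by (simp add: m_def)
  show ?thesis
  proof (cases "m = 0")
    \<comment> \<open>The claimed bound is 0 here, so the zero function alone and a point mass at
      \<open>(x0, 0)\<close>, under which its risk vanishes, suffice.\<close>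
    case True
    then have d: "d = 1" using floor_log2_bounds[OF assms(2) floor] by simp
    obtain x0 where x0: "x0 \<in> space M" using assms(4) by auto
    define g where "g = (\<lambda>x\<in>space M. 0 :: real)"
    define f where "f = (\<lambda>k :: unit. (x0, 0 :: real))"
    define P where "P = distr (measure_pmf (return_pmf ())) (M \<Otimes>\<^sub>M borel) f"
    have f: "f k \<in> space (M \<Otimes>\<^sub>M borel)" for k
      using x0 by (simp add: f_def space_pair_measure)
    have g: "g \<in> prediction_functions M"
      by (auto simp: g_def prediction_functions_def cong: measurable_cong)
    have "P \<in> distributions M"
      unfolding P_def by (rule distr_pmf_in_distributions[OF f])
    moreover have "(\<integral>\<^sup>+ (x, y). ennreal \<bar>y\<bar> \<partial>P) = 0"
    proof -
      have "f \<in> measurable (measure_pmf (return_pmf ())) (M \<Otimes>\<^sub>M borel)"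
        using f by (auto simp: measurable_def)
      then show ?thesis unfolding P_def by (simp add: nn_integral_distr case_prod_beta f_def)
    qed
    moreover have "risk P g = 0"
      unfolding P_def using g x0
      by (subst risk_distr_pmf[OF f, of UNIV])
         (auto simp: prediction_functions_def f_def g_def abs_loss_def)
    ultimately show ?thesis
      using g d assms(3)
      by (intro exI[of _ "{g}"]) (auto intro!: bexI[of _ P] simp: g_def zero_ennreal.rep_eq zero_ereal_def[symmetric])
  next
    case False
    then have m: "m > 0" by simp
    obtain x' where x': "bij_betw x' {..<m} V"
      using ex_bij_betw_nat_finite[OF V(2)] by (auto simp: m_def atLeast0LessThan)
    \<comment> \<open>Indices from \<open>m\<close> on repeat the point of index 0, so that
      \<open>x\<close> maps every natural number into \<open>space M\<close>, as the measurability
      of \<open>labelled_point\<close> on the discrete space demands.\<close>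
    define x where "x j = x' (if j < m then j else 0)" for j
    have x: "x j \<in> space M" for j
      using x' V(1) m by (auto simp: x_def bij_betw_def)
    have inj: "inj_on x {..<m}"
      using x' by (auto simp: x_def bij_betw_def inj_on_def)
    obtain G where G: "G \<subseteq> prediction_functions M" "finite G" "card G = d"
      "\<forall>g\<in>G. \<forall>x\<in>space M. \<bar>g x\<bar> \<le> b"
      and cube: "\<forall>S\<subseteq>{..<m}. \<exists>g\<in>G. \<forall>j<m. g (x j) = label_sign j S * b"
      using prediction_class_exists[OF assms(3-5) inj x floor_log2_bounds(1)[OF assms(2) floor]]
      by auto
    \<comment> \<open>This choice satisfies both constraints of the Assouad bound and turns the gain
      \<open>\<xi> * b / 2\<close> into the claimed quantity.\<close>
    define \<xi> where "\<xi> = sqrt (min (real m / real n) (1 / 4)) / 2"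
    have \<xi>: "0 \<le> \<xi>" "\<xi> \<le> 1 / 4" "real n * \<xi>\<^sup>2 \<le> real m / 4"
    proof -
      show "0 \<le> \<xi>" by (simp add: \<xi>_def)
      have "sqrt (min (real m / real n) (1 / 4)) \<le> 1 / 2"
        by (rule real_le_lsqrt) (auto simp: power2_eq_square min_def)
      then show "\<xi> \<le> 1 / 4" by (simp add: \<xi>_def)
      have "\<xi>\<^sup>2 = min (real m / real n) (1 / 4) / 4"
        by (simp add: \<xi>_def power_divide)
      also have "\<dots> \<le> real m / real n / 4" by simp
      finally show "real n * \<xi>\<^sup>2 \<le> real m / 4" using assms(1) by (simp add: field_simps)
    qed
    have "\<exists>P\<in>distributions M. (\<integral>\<^sup>+ (x, y). ennreal \<bar>y\<bar> \<partial>P) < \<infinity> \<and>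
        enn2ereal (expected_risk P n h) - enn2ereal (Min (risk P ` G)) \<ge> ereal (\<xi> * b / 2)"
      if h: "estimator M n h" for h
    proof -
      obtain S where S: "S \<subseteq> {..<m}"
        and le: "ennreal (b * (1 - \<xi>) + \<xi> * b / 2) \<le> expected_risk (cube_law M x b m \<xi> S) n h"
        using expected_risk_cube_law_ge[where x = x, OF x m assms(3) \<xi> h] by auto
      define P where "P = cube_law M x b m \<xi> S"
      obtain g where g: "g \<in> G" "\<And>j. j < m \<Longrightarrow> g (x j) = label_sign j S * b"
        using cube S by blast
      have "risk P g = ennreal (b * (1 - \<xi>))"
        unfolding P_def using g G(1) \<xi> assms(3)
        by (intro risk_cube_law_optimal x m) (auto simp: prediction_functions_def)
      \<comment> \<open>The minimum is subtracted, so the risk of one member serves as the required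
        upper bound.\<close>
      then have "Min (risk P ` G) \<le> ennreal (b * (1 - \<xi>))"
        using G(2) g(1) by (metis Min_le finite_imageI imageI)
      then have upper: "enn2ereal (Min (risk P ` G)) \<le> ereal (b * (1 - \<xi>))"
        using assms(3) \<xi>(2) unfolding less_eq_ennreal.rep_eq by (subst (asm) enn2ereal_ennreal) auto
      have lower: "ereal (b * (1 - \<xi>) + \<xi> * b / 2) \<le> enn2ereal (expected_risk P n h)"
        using le assms(3) \<xi> unfolding P_def less_eq_ennreal.rep_eq by (subst (asm) enn2ereal_ennreal) auto
      have "ereal (\<xi> * b / 2) = ereal (b * (1 - \<xi>) + \<xi> * b / 2) - ereal (b * (1 - \<xi>))" by simp
      also have "\<dots> \<le> enn2ereal (expected_risk P n h) - enn2ereal (Min (risk P ` G))"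
        by (rule ereal_minus_mono[OF lower upper])
      finally have "ereal (\<xi> * b / 2) \<le> enn2ereal (expected_risk P n h) - enn2ereal (Min (risk P ` G))" .
      moreover have "P \<in> distributions M"
        unfolding P_def cube_law_def by (intro distr_pmf_in_distributions labelled_point_in_space x)
      moreover have "(\<integral>\<^sup>+ (x, y). ennreal \<bar>y\<bar> \<partial>P) < \<infinity>"
        unfolding P_def by (simp add: nn_integral_abs_label_cube_law x assms(3))
      ultimately show ?thesis by blast
    qed
    moreover have "b / 4 * sqrt (min (real_of_int \<lfloor>log 2 (real (card G))\<rfloor> / real n) (1 / 4)) = \<xi> * b / 2"
      by (simp add: G(3) floor \<xi>_def)
    ultimately show ?thesis using G by metis
  qed
qed

end
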